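(* Let $f:\Sigma\to\Sigma'$ be an epimorphism between the continuous groupoid actions $(\Xi,\rho,\theta,\Sigma)$ and $(\Xi,\rho',\theta',\Sigma')$. (i) If $M\subset\Sigma$ is minimal and $f(M)$ is closed in $\Sigma'$, then $f(M)$ is minimal. (ii) Suppose that $\Sigma$ is compact (hence $\Sigma'$ is also compact). If $M'\subset\Sigma'$ is minimal, there exists $M\subset\Sigma$ minimal such that $f(M)=M'$. If $\Xi$ is open and locally compact and $\sigma'\in\Sigma'$ is almost periodic, then $\sigma'=f(\sigma)$ for some almost periodic point $\sigma$ of $\Sigma$.
   Context: All topological spaces are Hausdorff. A groupoid $\Xi$ is a small category in which all arrows are invertible; $X=\Xi^{(0)}$ is its unit space, $d,r:\Xi\to X$ are the source and range maps, and $\xi\eta$ is defined iff $d(\xi)=r(\eta)$. A topological groupoid is a groupoid with a (Hausdorff) topology making inversion and multiplication continuous (composable pairs carry the topology induced from $\Xi\times\Xi$); $X$ has the subspace topology. $\Xi$ is called open if $d:\Xi\to X$ is an open map. For $x\in X$, $\Xi_x=d^{-1}(\{x\})$. For $\mathsf A,\mathsf B\subset\Xi$, $\mathsf A\mathsf B=\{\xi\eta:\xi\in\mathsf A,\ \eta\in\mathsf B,\ d(\xi)=r(\eta)\}$. A continuous groupoid action $(\Xi,\rho,\theta,\Sigma)$ consists of a topological groupoid $\Xi$, a Hausdorff space $\Sigma$, a continuous surjection $\rho:\Sigma\to X$ (the anchor) and a continuous map $\theta:\{(\xi,\sigma)\in\Xi\times\Sigma: d(\xi)=\rho(\sigma)\}\to\Sigma$,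 $\theta_\xi(\sigma)=\xi\bullet\sigma$, with $\rho(\sigma)\bullet\sigma=\sigma$ and: if $d(\xi)=r(\eta)$ and $d(\eta)=\rho(\sigma)$ then $d(\xi)=\rho(\eta\bullet\sigma)$ and $(\xi\eta)\bullet\sigma=\xi\bullet(\eta\bullet\sigma)$. An epimorphism from $(\Xi,\rho,\theta,\Sigma)$ to $(\Xi,\rho',\theta',\Sigma')$ is a continuous surjection $f:\Sigma\to\Sigma'$ with $\rho'(f(\sigma))=\rho(\sigma)$ and $f(\theta_\xi(\sigma))=\theta'_\xi(f(\sigma))$ for all $\sigma\in\Sigma$, $\xi\in\Xi_{\rho(\sigma)}$. A subset $M\subset\Sigma$ is invariant if $\xi\bullet\tau\in M$ whenever $\tau\in M$ and $d(\xi)=\rho(\tau)$. A non-empty closed invariant subset is minimal if it contains no proper non-void closed invariant subset. A subset $\mathsf A\subset\Xi_x$ is syndetic (in $\Xi_x$) if $\mathsf K\mathsf A=\Xi_x$ for some compact $\mathsf K\subset\Xi$. A point $\sigma$ is almost periodic if $\{\xi\in\Xi_{\rho(\sigma)}:\xi\bullet\sigma\in U\}$ is syndetic in $\Xi_{\rho(\sigma)}$ for every neighborhood $U$ of $\sigma$. Same definitions for the action on $\Sigma'$. *)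

theory Defs
  imports "HOL-Analysis.Analysis"
begin

text \<open>Spaces are abstract topologies: the underlying set of a space \<open>T\<close> is \<open>topspace T\<close>. Operations
  are total functions of which only the values on the relevant carriers matter. The objects of the
  groupoid are identified with its identity arrows, so that the unit space is a set of arrows.\<close>

record 'g groupoid =
  arrows :: "'g topology"
  units :: "'g set"
  source :: "'g \<Rightarrow> 'g"
  target :: "'g \<Rightarrow> 'g"
  gmult :: "'g \<Rightarrow> 'g \<Rightarrow> 'g"
  ginv :: "'g \<Rightarrow> 'g"

definition unit_space :: "('g, 'm) groupoid_scheme \<Rightarrow> 'g topology" where
  "unit_space G = subtopology (arrows G) (units G)"

definition composable :: "('g, 'm) groupoid_scheme \<Rightarrow> ('g \<times> 'g) set" where
  "composable G = {(\<xi>, \<eta>). \<xi> \<in> topspace (arrows G) \<and> \<eta> \<in> topspace (arrows G)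
     \<and> source G \<xi> = target G \<eta>}"

definition source_fibre :: "('g, 'm) groupoid_scheme \<Rightarrow> 'g \<Rightarrow> 'g set" where
  "source_fibre G x = {\<xi> \<in> topspace (arrows G). source G \<xi> = x}"

definition set_gmult :: "('g, 'm) groupoid_scheme \<Rightarrow> 'g set \<Rightarrow> 'g set \<Rightarrow> 'g set" where
  "set_gmult G A B = {gmult G \<xi> \<eta> | \<xi> \<eta>. \<xi> \<in> A \<and> \<eta> \<in> B \<and> source G \<xi> = target G \<eta>}"

locale topological_groupoid =
  fixes G :: "('g, 'm) groupoid_scheme"
  assumes units_subset: "units G \<subseteq> topspace (arrows G)"
    and source_in_units: "\<xi> \<in> topspace (arrows G) \<Longrightarrow> source G \<xi> \<in> units G"
    and target_in_units: "\<xi> \<in> topspace (arrows G) \<Longrightarrow> target G \<xi> \<in> units G"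
    and source_unit: "x \<in> units G \<Longrightarrow> source G x = x"
    and target_unit: "x \<in> units G \<Longrightarrow> target G x = x"
    and gmult_closed: "(\<xi>, \<eta>) \<in> composable G \<Longrightarrow> gmult G \<xi> \<eta> \<in> topspace (arrows G)"
    and source_gmult: "(\<xi>, \<eta>) \<in> composable G \<Longrightarrow> source G (gmult G \<xi> \<eta>) = source G \<eta>"
    and target_gmult: "(\<xi>, \<eta>) \<in> composable G \<Longrightarrow> target G (gmult G \<xi> \<eta>) = target G \<xi>"
    and gmult_assoc: "(\<xi>, \<eta>) \<in> composable G \<Longrightarrow> (\<eta>, \<zeta>) \<in> composable G \<Longrightarrow>
      gmult G (gmult G \<xi> \<eta>) \<zeta> = gmult G \<xi> (gmult G \<eta> \<zeta>)"
    and left_unit: "\<xi> \<in> topspace (arrows G) \<Longrightarrow> gmult G (target G \<xi>) \<xi> = \<xi>"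
    and right_unit: "\<xi> \<in> topspace (arrows G) \<Longrightarrow> gmult G \<xi> (source G \<xi>) = \<xi>"
    and ginv_closed: "\<xi> \<in> topspace (arrows G) \<Longrightarrow> ginv G \<xi> \<in> topspace (arrows G)"
    and source_ginv: "\<xi> \<in> topspace (arrows G) \<Longrightarrow> source G (ginv G \<xi>) = target G \<xi>"
    and target_ginv: "\<xi> \<in> topspace (arrows G) \<Longrightarrow> target G (ginv G \<xi>) = source G \<xi>"
    and left_inverse: "\<xi> \<in> topspace (arrows G) \<Longrightarrow> gmult G (ginv G \<xi>) \<xi> = source G \<xi>"
    and right_inverse: "\<xi> \<in> topspace (arrows G) \<Longrightarrow> gmult G \<xi> (ginv G \<xi>) = target G \<xi>"
    and Hausdorff_arrows: "Hausdorff_space (arrows G)"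
    and continuous_ginv: "continuous_map (arrows G) (arrows G) (ginv G)"
    and continuous_gmult:
      "continuous_map (subtopology (prod_topology (arrows G) (arrows G)) (composable G))
         (arrows G) (\<lambda>(\<xi>, \<eta>). gmult G \<xi> \<eta>)"

definition open_groupoid :: "('g, 'm) groupoid_scheme \<Rightarrow> bool" where
  "open_groupoid G \<longleftrightarrow> open_map (arrows G) (unit_space G) (source G)"

record ('g, 's) groupoid_action =
  phase_space :: "'s topology"
  anchor :: "'s \<Rightarrow> 'g"
  act :: "'g \<Rightarrow> 's \<Rightarrow> 's"

definition actable :: "('g, 'm) groupoid_scheme \<Rightarrow> ('g, 's, 'n) groupoid_action_scheme \<Rightarrow> ('g \<times> 's) set" where
  "actable G S = {(\<xi>, \<sigma>). \<xi> \<in> topspace (arrows G) \<and> \<sigma> \<in> topspace (phase_space S)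
     \<and> source G \<xi> = anchor S \<sigma>}"

locale continuous_action = topological_groupoid G
  for G :: "('g, 'm) groupoid_scheme" +
  fixes S :: "('g, 's, 'n) groupoid_action_scheme"
  assumes Hausdorff_phase_space: "Hausdorff_space (phase_space S)"
    and continuous_anchor: "continuous_map (phase_space S) (unit_space G) (anchor S)"
    and anchor_surj: "anchor S ` topspace (phase_space S) = units G"
    and continuous_act:
      "continuous_map (subtopology (prod_topology (arrows G) (phase_space S)) (actable G S))
         (phase_space S) (\<lambda>(\<xi>, \<sigma>). act S \<xi> \<sigma>)"
    and act_unit: "\<sigma> \<in> topspace (phase_space S) \<Longrightarrow> act S (anchor S \<sigma>) \<sigma> = \<sigma>"
    and anchor_act: "(\<xi>, \<eta>) \<in> composable G \<Longrightarrow> (\<eta>, \<sigma>) \<in> actable G S \<Longrightarrow>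
      source G \<xi> = anchor S (act S \<eta> \<sigma>)"
    and act_gmult: "(\<xi>, \<eta>) \<in> composable G \<Longrightarrow> (\<eta>, \<sigma>) \<in> actable G S \<Longrightarrow>
      act S (gmult G \<xi> \<eta>) \<sigma> = act S \<xi> (act S \<eta> \<sigma>)"

definition action_epimorphism ::
  "('g, 'm) groupoid_scheme \<Rightarrow> ('g, 's, 'n) groupoid_action_scheme \<Rightarrow>
   ('g, 't, 'k) groupoid_action_scheme \<Rightarrow> ('s \<Rightarrow> 't) \<Rightarrow> bool" where
  "action_epimorphism G S S' f \<longleftrightarrow>
     continuous_map (phase_space S) (phase_space S') f \<and>
     f ` topspace (phase_space S) = topspace (phase_space S') \<and>
     (\<forall>\<sigma> \<in> topspace (phase_space S). anchor S' (f \<sigma>) = anchor S \<sigma>) \<and>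
     (\<forall>\<sigma> \<in> topspace (phase_space S). \<forall>\<xi> \<in> source_fibre G (anchor S \<sigma>).
        f (act S \<xi> \<sigma>) = act S' \<xi> (f \<sigma>))"

definition invariant_set ::
  "('g, 'm) groupoid_scheme \<Rightarrow> ('g, 's, 'n) groupoid_action_scheme \<Rightarrow> 's set \<Rightarrow> bool" where
  "invariant_set G S M \<longleftrightarrow> M \<subseteq> topspace (phase_space S) \<and>
     (\<forall>\<tau> \<in> M. \<forall>\<xi> \<in> source_fibre G (anchor S \<tau>). act S \<xi> \<tau> \<in> M)"

definition minimal_set ::
  "('g, 'm) groupoid_scheme \<Rightarrow> ('g, 's, 'n) groupoid_action_scheme \<Rightarrow> 's set \<Rightarrow> bool" where
  "minimal_set G S M \<longleftrightarrow>
     M \<noteq> {} \<and> closedin (phase_space S) M \<and> invariant_set G S M \<and>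
     \<not> (\<exists>N. N \<subset> M \<and> N \<noteq> {} \<and> closedin (phase_space S) N \<and> invariant_set G S N)"

definition syndetic :: "('g, 'm) groupoid_scheme \<Rightarrow> 'g \<Rightarrow> 'g set \<Rightarrow> bool" where
  "syndetic G x A \<longleftrightarrow> A \<subseteq> source_fibre G x \<and>
     (\<exists>K. compactin (arrows G) K \<and> set_gmult G K A = source_fibre G x)"

definition nbhd :: "'s topology \<Rightarrow> 's \<Rightarrow> 's set \<Rightarrow> bool" where
  "nbhd T \<sigma> U \<longleftrightarrow> U \<subseteq> topspace T \<and> (\<exists>V. openin T V \<and> \<sigma> \<in> V \<and> V \<subseteq> U)"

definition almost_periodic ::
  "('g, 'm) groupoid_scheme \<Rightarrow> ('g, 's, 'n) groupoid_action_scheme \<Rightarrow> 's \<Rightarrow> bool" where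
  "almost_periodic G S \<sigma> \<longleftrightarrow> \<sigma> \<in> topspace (phase_space S) \<and>
     (\<forall>U. nbhd (phase_space S) \<sigma> U \<longrightarrow>
        syndetic G (anchor S \<sigma>) {\<xi> \<in> source_fibre G (anchor S \<sigma>). act S \<xi> \<sigma> \<in> U})"

end

theory Submission
  imports Defs
begin

text \<open>The image of an invariant set under an epimorphism is invariant, and so is the part of an
  invariant set that is mapped into an invariant set. Hence a proper closed invariant part of
  \<open>f ` M\<close> would pull back to one of \<open>M\<close>, which gives the first claim. If the phase space is
  compact, Zorn's lemma yields a minimal set inside the preimage of \<open>M'\<close>; its image is compact,
  hence closed, so it is a non-empty closed invariant subset of \<open>M'\<close> and equals \<open>M'\<close>.

  The claim on almost periodic points is reduced to the one on minimal sets by a dictionary: over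
  an open groupoid acting on a compact space, the orbit closure of an almost periodic point is
  minimal (\<open>minimal_closure_of_orbit\<close>), and, if the groupoid is also locally compact,
  every point of a minimal set is almost periodic (\<open>almost_periodic_if_in_minimal\<close>). So one lifts
  the orbit closure of \<open>\<sigma>'\<close> to a minimal set \<open>M\<close> and takes for \<open>\<sigma>\<close> any point of \<open>M\<close> above \<open>\<sigma>'\<close>.

  Openness of the source map enters because only the arrows with the right source can be applied
  to a point: an arrow that moves \<open>\<tau>\<close> into an open set cannot itself be applied to the points near
  \<open>\<tau>\<close>, but arrows near it can (\<open>nearby_arrows_act\<close>).\<close>

section \<open>Elementary properties of groupoids and actions\<close>

context topological_groupoid
begin

lemma continuous_source: "continuous_map (arrows G) (arrows G) (source G)"
proof -
  have "continuous_map (arrows G)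
      (subtopology (prod_topology (arrows G) (arrows G)) (composable G)) (\<lambda>\<xi>. (ginv G \<xi>, \<xi>))"
    unfolding continuous_map_in_subtopology
    by (auto simp: continuous_map_pairwise o_def continuous_ginv composable_def ginv_closed
        source_ginv)
  from continuous_map_compose[OF this continuous_gmult]
  have "continuous_map (arrows G) (arrows G) (\<lambda>\<xi>. gmult G (ginv G \<xi>) \<xi>)"
    by (simp add: o_def)
  then show ?thesis
    by (rule continuous_map_eq) (simp add: left_inverse)
qed

end

definition orbit :: "('g, 'm) groupoid_scheme \<Rightarrow> ('g, 's, 'n) groupoid_action_scheme \<Rightarrow> 's \<Rightarrow> 's set"
  where "orbit G S \<sigma> = (\<lambda>\<xi>. act S \<xi> \<sigma>) ` source_fibre G (anchor S \<sigma>)"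

context continuous_action
begin

lemma anchor_in_units: "\<tau> \<in> topspace (phase_space S) \<Longrightarrow> anchor S \<tau> \<in> units G"
  using anchor_surj by blast

lemma act_in_topspace: "(\<xi>, \<tau>) \<in> actable G S \<Longrightarrow> act S \<xi> \<tau> \<in> topspace (phase_space S)"
  using continuous_map_image_subset_topspace[OF continuous_act]
  by (force simp: actable_def)

text \<open>The action axiom compares the anchor of \<open>\<xi> \<bullet> \<tau>\<close> with the source of an arrow composable
  with \<open>\<xi>\<close>; the unit at the target of \<open>\<xi>\<close> is such an arrow.\<close>

lemma anchor_act_eq_target:
  assumes "(\<xi>, \<tau>) \<in> actable G S"
  shows "anchor S (act S \<xi> \<tau>) = target G \<xi>"
proof -
  have \<xi>: "\<xi> \<in> topspace (arrows G)"
    using assms by (auto simp: actable_def)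
  have "target G \<xi> \<in> units G"
    using \<xi> by (rule target_in_units)
  then have "(target G \<xi>, \<xi>) \<in> composable G" "source G (target G \<xi>) = target G \<xi>"
    using \<xi> units_subset by (auto simp: composable_def source_unit)
  then show ?thesis
    using anchor_act[OF _ assms] by metis
qed

lemma ginv_act:
  assumes "(\<xi>, \<tau>) \<in> actable G S"
  shows "act S (ginv G \<xi>) (act S \<xi> \<tau>) = \<tau>"
proof -
  have "(ginv G \<xi>, \<xi>) \<in> composable G" "\<xi> \<in> topspace (arrows G)"
    using assms by (auto simp: actable_def composable_def ginv_closed source_ginv)
  then have "act S (ginv G \<xi>) (act S \<xi> \<tau>) = act S (source G \<xi>) \<tau>"
    using act_gmult[OF _ assms] by (metis left_inverse)
  also have "\<dots> = \<tau>"
    using assms act_unit by (auto simp: actable_def)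
  finally show ?thesis .
qed

lemma orbit_subset: "\<tau> \<in> topspace (phase_space S) \<Longrightarrow> orbit G S \<tau> \<subseteq> topspace (phase_space S)"
  by (auto simp: orbit_def source_fibre_def actable_def intro!: act_in_topspace)

lemma in_own_orbit:
  assumes "\<tau> \<in> topspace (phase_space S)"
  shows "\<tau> \<in> orbit G S \<tau>"
proof -
  have "anchor S \<tau> \<in> source_fibre G (anchor S \<tau>)"
    using anchor_in_units[OF assms] units_subset source_unit by (auto simp: source_fibre_def)
  then show ?thesis
    unfolding orbit_def using act_unit[OF assms] by (metis imageI)
qed

lemma orbit_invariant:
  assumes \<tau>: "\<tau> \<in> topspace (phase_space S)"
  shows "invariant_set G S (orbit G S \<tau>)"
  unfolding invariant_set_def
proof (intro conjI ballI orbit_subset[OF \<tau>])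
  fix \<upsilon> \<xi>
  assume "\<upsilon> \<in> orbit G S \<tau>" and \<xi>: "\<xi> \<in> source_fibre G (anchor S \<upsilon>)"
  then obtain \<eta> where \<eta>: "\<eta> \<in> source_fibre G (anchor S \<tau>)" and \<upsilon>: "\<upsilon> = act S \<eta> \<tau>"
    by (auto simp: orbit_def)
  have a: "(\<eta>, \<tau>) \<in> actable G S"
    using \<eta> \<tau> by (auto simp: source_fibre_def actable_def)
  have c: "(\<xi>, \<eta>) \<in> composable G"
    using \<xi> \<eta> \<upsilon> anchor_act_eq_target[OF a] by (auto simp: source_fibre_def composable_def)
  have "gmult G \<xi> \<eta> \<in> source_fibre G (anchor S \<tau>)"
    using \<eta> gmult_closed[OF c] source_gmult[OF c] by (auto simp: source_fibre_def)
  then show "act S \<xi> \<upsilon> \<in> orbit G S \<tau>"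
    unfolding orbit_def using act_gmult[OF c a] \<upsilon> by (metis imageI)
qed

lemma orbit_subset_invariant:
  "invariant_set G S M \<Longrightarrow> \<tau> \<in> M \<Longrightarrow> orbit G S \<tau> \<subseteq> M"
  by (auto simp: invariant_set_def orbit_def)

section \<open>Orbit closures over an open groupoid\<close>

text \<open>An arrow near \<open>\<xi>\<close> moves a point near \<open>\<tau>\<close> into \<open>V\<close> by continuity, provided that it can be
  applied. As the source map is open, the sources of the arrows near \<open>\<xi>\<close> fill a
  neighbourhood of the anchor of \<open>\<tau>\<close>, so each point near \<open>\<tau>\<close> has such an arrow.\<close>

lemma nearby_arrows_act:
  assumes "open_groupoid G" and a: "(\<xi>, \<tau>) \<in> actable G S"
    and V: "openin (phase_space S) V" "act S \<xi> \<tau> \<in> V"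
    and A: "openin (arrows G) A" "\<xi> \<in> A"
  obtains B where "openin (phase_space S) B" "\<tau> \<in> B"
    "\<And>\<upsilon>. \<upsilon> \<in> B \<Longrightarrow> \<exists>\<alpha>\<in>A. (\<alpha>, \<upsilon>) \<in> actable G S \<and> act S \<alpha> \<upsilon> \<in> V"
proof -
  let ?P = "prod_topology (arrows G) (phase_space S)"
  have "openin (subtopology ?P (actable G S))
      {z \<in> topspace (subtopology ?P (actable G S)). (\<lambda>(\<xi>, \<sigma>). act S \<xi> \<sigma>) z \<in> V}"
    using continuous_act V(1) by (rule openin_continuous_map_preimage)
  then obtain T where T: "openin ?P T"
    and eq: "{z \<in> topspace (subtopology ?P (actable G S)). (\<lambda>(\<xi>, \<sigma>). act S \<xi> \<sigma>) z \<in> V}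
      = T \<inter> actable G S"
    unfolding openin_subtopology by blast
  have T_iff: "(\<alpha>, \<upsilon>) \<in> T \<longleftrightarrow> act S \<alpha> \<upsilon> \<in> V" if "(\<alpha>, \<upsilon>) \<in> actable G S" for \<alpha> \<upsilon>
    using eqset_imp_iff[OF eq, of "(\<alpha>, \<upsilon>)"] that by (simp add: actable_def)
  have "(\<xi>, \<tau>) \<in> T"
    using T_iff[OF a] V(2) by simp
  then obtain A1 B1 where AB: "openin (arrows G) A1" "openin (phase_space S) B1"
      "\<xi> \<in> A1" "\<tau> \<in> B1" "A1 \<times> B1 \<subseteq> T"
    using T[unfolded openin_prod_topology_alt, rule_format, of \<xi> \<tau>] by metis
  define B where "B = B1 \<inter> {\<upsilon> \<in> topspace (phase_space S). anchor S \<upsilon> \<in> source G ` (A1 \<inter> A)}"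
  have "openin (unit_space G) (source G ` (A1 \<inter> A))"
    using assms(1) AB(1) A(1) unfolding open_groupoid_def open_map_def by blast
  then have "openin (phase_space S) B"
    unfolding B_def using AB(2) openin_continuous_map_preimage[OF continuous_anchor] by blast
  moreover have "\<tau> \<in> B"
    using a AB A unfolding B_def actable_def by force
  moreover have "\<exists>\<alpha>\<in>A. (\<alpha>, \<upsilon>) \<in> actable G S \<and> act S \<alpha> \<upsilon> \<in> V" if \<upsilon>: "\<upsilon> \<in> B" for \<upsilon>
  proof -
    obtain \<alpha> where \<alpha>: "\<alpha> \<in> A1" "\<alpha> \<in> A" "anchor S \<upsilon> = source G \<alpha>"
      using \<upsilon> unfolding B_def by blast
    have act: "(\<alpha>, \<upsilon>) \<in> actable G S"
      using \<alpha> \<upsilon> openin_subset[OF A(1)] by (auto simp: B_def actable_def)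
    have "(\<alpha>, \<upsilon>) \<in> T"
      using \<alpha>(1) \<upsilon> AB(5) by (auto simp: B_def)
    then show ?thesis
      using act \<alpha>(2) T_iff by blast
  qed
  ultimately show ?thesis by (rule that)
qed

lemma closure_of_invariant:
  assumes "open_groupoid G" and M: "invariant_set G S M"
  shows "invariant_set G S (phase_space S closure_of M)"
  unfolding invariant_set_def
proof (intro conjI ballI closure_of_subset_topspace)
  fix \<tau> \<xi>
  assume \<tau>: "\<tau> \<in> phase_space S closure_of M" and \<xi>: "\<xi> \<in> source_fibre G (anchor S \<tau>)"
  have a: "(\<xi>, \<tau>) \<in> actable G S"
    using \<tau> \<xi> by (auto simp: source_fibre_def actable_def in_closure_of)
  have "\<exists>\<upsilon>. \<upsilon> \<in> M \<and> \<upsilon> \<in> V" if V: "act S \<xi> \<tau> \<in> V" "openin (phase_space S) V" for V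
  proof -
    have "\<xi> \<in> topspace (arrows G)"
      using \<xi> by (auto simp: source_fibre_def)
    from nearby_arrows_act[OF assms(1) a V(2,1) openin_topspace this]
    obtain B where B: "openin (phase_space S) B" "\<tau> \<in> B"
      "\<And>\<upsilon>. \<upsilon> \<in> B \<Longrightarrow> \<exists>\<alpha>\<in>topspace (arrows G). (\<alpha>, \<upsilon>) \<in> actable G S \<and> act S \<alpha> \<upsilon> \<in> V"
      by blast
    obtain \<upsilon> where \<upsilon>: "\<upsilon> \<in> M" "\<upsilon> \<in> B"
      using \<tau> B(1,2) unfolding in_closure_of by blast
    then show ?thesis
      using B(3) M by (fastforce simp: invariant_set_def source_fibre_def actable_def)
  qed
  then show "act S \<xi> \<tau> \<in> phase_space S closure_of M"
    using act_in_topspace[OF a] by (auto simp: in_closure_of)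
qed

section \<open>Minimal sets and almost periodic points\<close>

lemma minimal_setD:
  assumes "minimal_set G S M" "N \<subseteq> M" "N \<noteq> {}" "closedin (phase_space S) N" "invariant_set G S N"
  shows "N = M"
  using assms unfolding minimal_set_def by blast

lemma closure_of_orbit_if_minimal:
  assumes "open_groupoid G" and M: "minimal_set G S M" and \<tau>: "\<tau> \<in> M"
  shows "phase_space S closure_of orbit G S \<tau> = M"
proof (rule minimal_setD[OF M])
  have M': "closedin (phase_space S) M" "invariant_set G S M"
    using M by (auto simp: minimal_set_def)
  have top: "\<tau> \<in> topspace (phase_space S)"
    using \<tau> M' by (auto simp: invariant_set_def)
  show "phase_space S closure_of orbit G S \<tau> \<subseteq> M"
    using orbit_subset_invariant[OF M'(2) \<tau>] M'(1) by (rule closure_of_minimal)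
  show "phase_space S closure_of orbit G S \<tau> \<noteq> {}"
    using in_own_orbit[OF top] closure_of_subset[OF orbit_subset[OF top]] by blast
  show "invariant_set G S (phase_space S closure_of orbit G S \<tau>)"
    by (rule closure_of_invariant[OF assms(1) orbit_invariant[OF top]])
qed simp

text \<open>Let \<open>V\<close> be an open neighbourhood of \<open>\<sigma>\<close>. Every orbit in \<open>M\<close> is dense in \<open>M\<close> and so
  meets \<open>V\<close>. By compactness of \<open>M\<close> the arrows that lead from the points of \<open>M\<close> into \<open>V\<close> can
  be taken from one compact set \<open>C\<close>, a finite union of compact neighbourhoods. For \<open>\<xi>\<close> in the source fibre of \<open>\<sigma>\<close>, apply this to the point
  \<open>\<xi> \<bullet> \<sigma>\<close>: some \<open>\<kappa> \<in> C\<close> has \<open>\<kappa>\<xi>\<close> among the return times, and \<open>\<xi> = \<kappa>\<inverse>(\<kappa>\<xi>)\<close>. So \<open>C\<inverse>\<close>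
  witnesses that the return times are syndetic.\<close>

lemma almost_periodic_if_in_minimal:
  assumes op: "open_groupoid G" and lc: "locally_compact_space (arrows G)"
    and comp: "compact_space (phase_space S)"
    and M: "minimal_set G S M" and \<sigma>: "\<sigma> \<in> M"
  shows "almost_periodic G S \<sigma>"
  unfolding almost_periodic_def
proof (intro conjI allI impI)
  have M': "closedin (phase_space S) M" "invariant_set G S M"
    using M by (auto simp: minimal_set_def)
  show top: "\<sigma> \<in> topspace (phase_space S)"
    using \<sigma> M' by (auto simp: invariant_set_def)
  fix U
  assume "nbhd (phase_space S) \<sigma> U"
  then obtain V where V: "openin (phase_space S) V" "\<sigma> \<in> V" "V \<subseteq> U"
    by (auto simp: nbhd_def)
  have "\<exists>B K. openin (phase_space S) B \<and> \<tau> \<in> B \<and> compactin (arrows G) K \<and>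
      (\<forall>\<upsilon>\<in>B. \<exists>\<alpha>\<in>K. (\<alpha>, \<upsilon>) \<in> actable G S \<and> act S \<alpha> \<upsilon> \<in> V)" if \<tau>: "\<tau> \<in> M" for \<tau>
  proof -
    have "\<sigma> \<in> phase_space S closure_of orbit G S \<tau>"
      using closure_of_orbit_if_minimal[OF op M \<tau>] \<sigma> by simp
    then obtain \<xi> where \<xi>: "\<xi> \<in> source_fibre G (anchor S \<tau>)" "act S \<xi> \<tau> \<in> V"
      using V(1,2) unfolding in_closure_of orbit_def by blast
    then obtain A K where AK: "openin (arrows G) A" "compactin (arrows G) K" "\<xi> \<in> A" "A \<subseteq> K"
      using lc unfolding locally_compact_space_def source_fibre_def by blast
    have "(\<xi>, \<tau>) \<in> actable G S"
      using \<xi>(1) \<tau> M' by (auto simp: source_fibre_def actable_def invariant_set_def)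
    from nearby_arrows_act[OF op this V(1) \<xi>(2) AK(1,3)]
    show ?thesis
      using AK(2,4) by (metis subsetD)
  qed
  then obtain B K where BK: "\<And>\<tau>. \<tau> \<in> M \<Longrightarrow> openin (phase_space S) (B \<tau>)"
      "\<And>\<tau>. \<tau> \<in> M \<Longrightarrow> \<tau> \<in> B \<tau>" "\<And>\<tau>. \<tau> \<in> M \<Longrightarrow> compactin (arrows G) (K \<tau>)"
      "\<And>\<tau> \<upsilon>. \<tau> \<in> M \<Longrightarrow> \<upsilon> \<in> B \<tau> \<Longrightarrow>
        \<exists>\<alpha>\<in>K \<tau>. (\<alpha>, \<upsilon>) \<in> actable G S \<and> act S \<alpha> \<upsilon> \<in> V"
    by metis
  have "compactin (phase_space S) M"
    using comp M'(1) by (rule closedin_compact_space)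
  moreover have "\<forall>W \<in> B ` M. openin (phase_space S) W" "M \<subseteq> \<Union> (B ` M)"
    using BK(1,2) by auto
  ultimately obtain \<F> where \<F>: "finite \<F>" "\<F> \<subseteq> B ` M" "M \<subseteq> \<Union> \<F>"
    unfolding compactin_def by metis
  then obtain F where F: "finite F" "F \<subseteq> M" "M \<subseteq> \<Union> (B ` F)"
    by (metis finite_subset_image)
  define C where "C = \<Union> (K ` F)"
  have C: "compactin (arrows G) C"
    unfolding C_def using F BK(3) by (auto intro!: compactin_Union)
  define R where "R = {\<xi> \<in> source_fibre G (anchor S \<sigma>). act S \<xi> \<sigma> \<in> U}"
  have "compactin (arrows G) (ginv G ` C)"
    using C continuous_ginv by (rule image_compactin)
  moreover have "set_gmult G (ginv G ` C) R = source_fibre G (anchor S \<sigma>)"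
  proof (intro equalityI subsetI)
    fix \<zeta> assume "\<zeta> \<in> set_gmult G (ginv G ` C) R"
    then obtain \<kappa> \<eta> where k: "\<kappa> \<in> C" "\<eta> \<in> R" "source G (ginv G \<kappa>) = target G \<eta>"
        "\<zeta> = gmult G (ginv G \<kappa>) \<eta>"
      by (auto simp: set_gmult_def)
    have "\<kappa> \<in> topspace (arrows G)"
      using k(1) C compactin_subset_topspace by blast
    then have "(ginv G \<kappa>, \<eta>) \<in> composable G"
      using k by (auto simp: composable_def R_def source_fibre_def ginv_closed)
    then show "\<zeta> \<in> source_fibre G (anchor S \<sigma>)"
      using gmult_closed source_gmult k by (auto simp: source_fibre_def R_def)
  next
    fix \<zeta> assume \<zeta>: "\<zeta> \<in> source_fibre G (anchor S \<sigma>)"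
    have a: "(\<zeta>, \<sigma>) \<in> actable G S"
      using \<zeta> top by (auto simp: source_fibre_def actable_def)
    have "act S \<zeta> \<sigma> \<in> M"
      using M'(2) \<sigma> \<zeta> by (auto simp: invariant_set_def)
    then obtain \<kappa> where \<kappa>: "\<kappa> \<in> C" "(\<kappa>, act S \<zeta> \<sigma>) \<in> actable G S"
        "act S \<kappa> (act S \<zeta> \<sigma>) \<in> V"
      using F BK(4) unfolding C_def by blast
    have t: "\<kappa> \<in> topspace (arrows G)" "\<zeta> \<in> topspace (arrows G)" "source G \<kappa> = target G \<zeta>"
      using \<kappa>(2) \<zeta> anchor_act_eq_target[OF a] by (auto simp: actable_def source_fibre_def)
    then have c: "(\<kappa>, \<zeta>) \<in> composable G" "(ginv G \<kappa>, \<kappa>) \<in> composable G"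
      by (auto simp: composable_def ginv_closed source_ginv)
    have "gmult G (ginv G \<kappa>) (gmult G \<kappa> \<zeta>) = gmult G (source G \<kappa>) \<zeta>"
      using gmult_assoc[OF c(2,1)] t(1) by (simp add: left_inverse)
    also have "\<dots> = \<zeta>"
      using t left_unit by simp
    finally have "gmult G (ginv G \<kappa>) (gmult G \<kappa> \<zeta>) = \<zeta>" .
    moreover have "gmult G \<kappa> \<zeta> \<in> R"
      using \<zeta> gmult_closed[OF c(1)] source_gmult[OF c(1)] act_gmult[OF c(1) a] \<kappa>(3) V(3)
      by (auto simp: R_def source_fibre_def)
    moreover have "source G (ginv G \<kappa>) = target G (gmult G \<kappa> \<zeta>)"
      using t(1) target_gmult[OF c(1)] source_ginv by simp
    ultimately show "\<zeta> \<in> set_gmult G (ginv G ` C) R"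
      using \<kappa>(1) unfolding set_gmult_def mem_Collect_eq by (metis imageI)
  qed
  ultimately show "syndetic G (anchor S \<sigma>) {\<xi> \<in> source_fibre G (anchor S \<sigma>). act S \<xi> \<sigma> \<in> U}"
    unfolding syndetic_def R_def by blast
qed

text \<open>The pairs in \<open>K \<times> C\<close> that can act form a closed, hence compact, subset, because the
  condition equates two continuous maps into the Hausdorff space of arrows.\<close>

lemma compactin_act:
  assumes "compactin (arrows G) K" "compactin (phase_space S) C"
  shows "compactin (phase_space S) ((\<lambda>(\<xi>, \<tau>). act S \<xi> \<tau>) ` (K \<times> C \<inter> actable G S))"
proof (rule image_compactin[OF _ continuous_act])
  let ?P = "prod_topology (arrows G) (phase_space S)"
  have "continuous_map ?P (arrows G) (source G \<circ> fst)"
    by (rule continuous_map_compose[OF continuous_map_fst continuous_source])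
  moreover have "continuous_map (phase_space S) (arrows G) (anchor S)"
    using continuous_anchor by (simp add: unit_space_def continuous_map_in_subtopology)
  then have "continuous_map ?P (arrows G) (anchor S \<circ> snd)"
    by (rule continuous_map_compose[OF continuous_map_snd])
  ultimately have "closedin ?P {z \<in> topspace ?P. (source G \<circ> fst) z = (anchor S \<circ> snd) z}"
    using closedin_continuous_maps_eq[OF Hausdorff_arrows] by blast
  also have "{z \<in> topspace ?P. (source G \<circ> fst) z = (anchor S \<circ> snd) z} = actable G S"
    by (auto simp: actable_def)
  finally have "compactin ?P (K \<times> C \<inter> actable G S)"
    using assms by (metis compactin_Times compact_Int_closedin)
  then show "compactin (subtopology ?P (actable G S)) (K \<times> C \<inter> actable G S)"
    by (simp add: compactin_subtopology)
qed

text \<open>A closed invariant set that contains \<open>\<sigma>\<close> contains the whole orbit closure. So suppose that a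
  non-empty closed invariant subset \<open>N\<close> of the orbit closure misses \<open>\<sigma>\<close>. Separate \<open>\<sigma>\<close>
  from \<open>N\<close> by a neighbourhood \<open>U\<close> with closure \<open>C\<close> disjoint from \<open>N\<close>. As the return times to
  \<open>U\<close> are syndetic, the orbit lies in \<open>K \<bullet> C\<close> for a compact \<open>K\<close>. This set is closed, so it
  contains \<open>N\<close> as well; but moving a point \<open>\<kappa> \<bullet> \<upsilon> \<in> N\<close> back by \<open>\<kappa>\<inverse>\<close> gives a point
  \<open>\<upsilon> \<in> N \<inter> C\<close>.\<close>

lemma minimal_closure_of_orbit:
  assumes op: "open_groupoid G" and comp: "compact_space (phase_space S)"
    and ap: "almost_periodic G S \<sigma>"
  shows "minimal_set G S (phase_space S closure_of orbit G S \<sigma>)" (is "minimal_set G S ?M")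
proof -
  have top: "\<sigma> \<in> topspace (phase_space S)"
    using ap by (simp add: almost_periodic_def)
  have ne: "?M \<noteq> {}"
    using in_own_orbit[OF top] closure_of_subset[OF orbit_subset[OF top]] by blast
  have "N = ?M" if N: "N \<subseteq> ?M" "N \<noteq> {}" "closedin (phase_space S) N" "invariant_set G S N" for N
  proof (cases "\<sigma> \<in> N")
    case True
    then have "?M \<subseteq> N"
      using orbit_subset_invariant[OF N(4)] N(3) closure_of_minimal by metis
    with N(1) show ?thesis by blast
  next
    case False
    have "regular_space (phase_space S)"
      using comp Hausdorff_phase_space by (simp add: compact_Hausdorff_imp_regular_space)
    then obtain U W where UW: "openin (phase_space S) U" "openin (phase_space S) W" "\<sigma> \<in> U"
        "N \<subseteq> W" "disjnt U W"
      using N(3) False top unfolding regular_space_def by (metis DiffI)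
    define C where "C = phase_space S closure_of U"
    have C: "compactin (phase_space S) C"
      unfolding C_def using comp by (intro closedin_compact_space) auto
    have CN: "C \<inter> N = {}"
    proof -
      have "W \<inter> C = {}"
        using UW(2,5) unfolding C_def by (auto simp: openin_Int_closure_of_eq_empty disjnt_def)
      with UW(4) show ?thesis by blast
    qed
    have "nbhd (phase_space S) \<sigma> U"
      using UW openin_subset unfolding nbhd_def by blast
    then obtain K where K: "compactin (arrows G) K"
      and syn: "set_gmult G K {\<xi> \<in> source_fibre G (anchor S \<sigma>). act S \<xi> \<sigma> \<in> U}
        = source_fibre G (anchor S \<sigma>)"
      using ap unfolding almost_periodic_def syndetic_def by blast
    define D where "D = (\<lambda>(\<xi>, \<tau>). act S \<xi> \<tau>) ` (K \<times> C \<inter> actable G S)"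
    have "orbit G S \<sigma> \<subseteq> D"
    proof
      fix \<upsilon> assume "\<upsilon> \<in> orbit G S \<sigma>"
      then obtain \<xi> where "\<xi> \<in> source_fibre G (anchor S \<sigma>)" and \<upsilon>: "\<upsilon> = act S \<xi> \<sigma>"
        by (auto simp: orbit_def)
      then have "\<xi> \<in> set_gmult G K {\<xi> \<in> source_fibre G (anchor S \<sigma>). act S \<xi> \<sigma> \<in> U}"
        using syn by simp
      then obtain \<kappa> \<eta> where k: "\<kappa> \<in> K" "\<eta> \<in> source_fibre G (anchor S \<sigma>)" "act S \<eta> \<sigma> \<in> U"
          "source G \<kappa> = target G \<eta>" "\<xi> = gmult G \<kappa> \<eta>"
        unfolding set_gmult_def by blast
      have a: "(\<eta>, \<sigma>) \<in> actable G S"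
        using k(2) top by (auto simp: source_fibre_def actable_def)
      have \<kappa>: "\<kappa> \<in> topspace (arrows G)"
        using k(1) K compactin_subset_topspace by blast
      have "(\<kappa>, \<eta>) \<in> composable G"
        using \<kappa> k by (auto simp: composable_def source_fibre_def)
      then have "\<upsilon> = act S \<kappa> (act S \<eta> \<sigma>)"
        using \<upsilon> k(5) act_gmult a by simp
      moreover have "act S \<eta> \<sigma> \<in> C"
        using k(3) closure_of_subset[OF openin_subset[OF UW(1)]] unfolding C_def by blast
      moreover have "(\<kappa>, act S \<eta> \<sigma>) \<in> actable G S"
        using \<kappa> k(4) anchor_act_eq_target[OF a] act_in_topspace[OF a] by (simp add: actable_def)
      ultimately show "\<upsilon> \<in> D"
        unfolding D_def using k(1) by force
    qed
    moreover have "closedin (phase_space S) D"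
      unfolding D_def
      by (rule compactin_imp_closedin[OF Hausdorff_phase_space compactin_act[OF K C]])
    ultimately have "?M \<subseteq> D"
      by (rule closure_of_minimal)
    then have "N \<subseteq> D"
      using N(1) by (rule order_trans[rotated])
    moreover obtain \<nu> where "\<nu> \<in> N"
      using N(2) by blast
    ultimately have "\<nu> \<in> D"
      by blast
    with \<open>\<nu> \<in> N\<close> obtain \<kappa> \<upsilon> where k: "\<upsilon> \<in> C" "(\<kappa>, \<upsilon>) \<in> actable G S" "act S \<kappa> \<upsilon> \<in> N"
      by (auto simp: D_def)
    have "ginv G \<kappa> \<in> source_fibre G (anchor S (act S \<kappa> \<upsilon>))"
      using k(2) anchor_act_eq_target[OF k(2)] ginv_closed source_ginv
      by (auto simp: source_fibre_def actable_def)
    then have "\<upsilon> \<in> N"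
      using N(4) k(3) ginv_act[OF k(2)] unfolding invariant_set_def by metis
    with k(1) CN show ?thesis by blast
  qed
  then show ?thesis
    unfolding minimal_set_def
    using ne closure_of_invariant[OF op orbit_invariant[OF top]]
    by (metis closedin_closure_of psubset_eq)
qed

text \<open>Zorn's lemma for reverse inclusion: in a compact space the intersection of a chain of
  non-empty closed sets is non-empty.\<close>

lemma minimal_subset_exists:
  assumes comp: "compact_space (phase_space S)"
    and N: "N \<noteq> {}" "closedin (phase_space S) N" "invariant_set G S N"
  obtains M where "M \<subseteq> N" "minimal_set G S M"
proof -
  define \<A> where "\<A> = {L. L \<subseteq> N \<and> L \<noteq> {} \<and> closedin (phase_space S) L \<and> invariant_set G S L}"
  let ?R = "relation_of (\<lambda>L L'. L' \<subseteq> L) \<A>"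
  have po: "partial_order_on \<A> ?R"
    by (rule partial_order_on_relation_ofI) auto
  have bound: "\<exists>L\<in>\<A>. \<forall>L'\<in>\<C>. L \<subseteq> L'" if \<C>: "\<C> \<in> Chains ?R" for \<C>
  proof (cases "\<C> = {}")
    case True
    with N show ?thesis by (auto simp: \<A>_def)
  next
    case False
    have sub: "\<C> \<subseteq> \<A>"
      using \<C> by (auto simp: Chains_def relation_of_def)
    have chain: "L \<subseteq> L' \<or> L' \<subseteq> L" if "L \<in> \<C>" "L' \<in> \<C>" for L L'
      using \<C> that by (auto simp: Chains_def relation_of_def)
    have fin: "\<Inter>\<F> \<noteq> {}" if "finite \<F>" "\<F> \<subseteq> \<C>" for \<F>
    proof (cases "\<F> = {}")
      case False
      then have "\<Inter>\<F> \<in> \<F>"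
        using chain that by (intro finite_Inf_in) (metis inf.absorb1 inf.absorb2 subsetD)+
      then show ?thesis
        using that sub by (auto simp: \<A>_def)
    qed simp
    have "\<Inter>\<C> \<noteq> {}"
    proof -
      have "\<forall>L\<in>\<C>. closedin (phase_space S) L"
        using sub by (auto simp: \<A>_def)
      then show ?thesis
        using comp[unfolded compact_space_fip, rule_format, of \<C>] fin by metis
    qed
    moreover have "closedin (phase_space S) (\<Inter>\<C>)"
      using sub False by (intro closedin_Inter) (auto simp: \<A>_def)
    moreover have "invariant_set G S (\<Inter>\<C>)"
    proof -
      have "invariant_set G S L" if "L \<in> \<C>" for L
        using sub that by (auto simp: \<A>_def)
      then show ?thesis
        using False unfolding invariant_set_def by blast
    qed
    moreover have "\<Inter>\<C> \<subseteq> N"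
      using sub False by (auto simp: \<A>_def)
    ultimately show ?thesis
      by (intro bexI[of _ "\<Inter>\<C>"]) (auto simp: \<A>_def)
  qed
  obtain M where M: "M \<in> \<A>" "\<And>L. L \<in> \<A> \<Longrightarrow> L \<subseteq> M \<Longrightarrow> L = M"
    using predicate_Zorn[OF po bound] by blast
  have "minimal_set G S M"
    using M unfolding \<A>_def minimal_set_def by blast
  with M(1) show ?thesis
    using that by (auto simp: \<A>_def)
qed

end

section \<open>Epimorphisms\<close>

lemma epimorphism_image_invariant:
  assumes "action_epimorphism G S S' f" and "invariant_set G S M"
  shows "invariant_set G S' (f ` M)"
  unfolding invariant_set_def
proof (intro conjI ballI)
  show "f ` M \<subseteq> topspace (phase_space S')"
    using assms unfolding action_epimorphism_def invariant_set_def by blast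
  fix \<tau>' \<xi>
  assume "\<tau>' \<in> f ` M" and \<xi>: "\<xi> \<in> source_fibre G (anchor S' \<tau>')"
  then obtain \<tau> where \<tau>: "\<tau> \<in> M" "\<tau>' = f \<tau>" by blast
  then have "\<tau> \<in> topspace (phase_space S)" "\<xi> \<in> source_fibre G (anchor S \<tau>)"
    using assms \<xi> by (auto simp: action_epimorphism_def invariant_set_def)
  then have "act S' \<xi> \<tau>' = f (act S \<xi> \<tau>)" "act S \<xi> \<tau> \<in> M"
    using assms \<tau> by (auto simp: action_epimorphism_def invariant_set_def)
  then show "act S' \<xi> \<tau>' \<in> f ` M" by blast
qed

lemma epimorphism_preimage_invariant:
  assumes "action_epimorphism G S S' f" and "invariant_set G S M" and "invariant_set G S' N"
  shows "invariant_set G S {\<tau> \<in> M. f \<tau> \<in> N}"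
  unfolding invariant_set_def
proof (intro conjI ballI CollectI)
  show "{\<tau> \<in> M. f \<tau> \<in> N} \<subseteq> topspace (phase_space S)"
    using assms(2) by (auto simp: invariant_set_def)
  fix \<tau> \<xi>
  assume "\<tau> \<in> {\<tau> \<in> M. f \<tau> \<in> N}" and \<xi>: "\<xi> \<in> source_fibre G (anchor S \<tau>)"
  then have \<tau>: "\<tau> \<in> M" "f \<tau> \<in> N"
    by auto
  show "act S \<xi> \<tau> \<in> M"
    using assms(2) \<tau>(1) \<xi> by (auto simp: invariant_set_def)
  have "\<tau> \<in> topspace (phase_space S)"
    using assms(2) \<tau>(1) by (auto simp: invariant_set_def)
  then have "anchor S' (f \<tau>) = anchor S \<tau>" "f (act S \<xi> \<tau>) = act S' \<xi> (f \<tau>)"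
    using assms(1) \<xi> by (auto simp: action_epimorphism_def)
  then show "f (act S \<xi> \<tau>) \<in> N"
    using assms(3) \<tau>(2) \<xi> by (auto simp: invariant_set_def)
qed

lemma epimorphism_preimage_closed:
  assumes "action_epimorphism G S S' f"
    and "closedin (phase_space S) M" and "closedin (phase_space S') N"
  shows "closedin (phase_space S) {\<tau> \<in> M. f \<tau> \<in> N}"
proof -
  have "continuous_map (phase_space S) (phase_space S') f"
    using assms(1) by (simp add: action_epimorphism_def)
  then have "closedin (phase_space S) (M \<inter> {\<tau> \<in> topspace (phase_space S). f \<tau> \<in> N})"
    using assms(2,3) by (intro closedin_Int closedin_continuous_map_preimage)
  also have "M \<inter> {\<tau> \<in> topspace (phase_space S). f \<tau> \<in> N} = {\<tau> \<in> M. f \<tau> \<in> N}"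
    using closedin_subset[OF assms(2)] by blast
  finally show ?thesis .
qed

lemma epimorphism_image_minimal:
  assumes epi: "action_epimorphism G S S' f" and M: "minimal_set G S M"
    and cl: "closedin (phase_space S') (f ` M)"
  shows "minimal_set G S' (f ` M)"
proof -
  have M': "M \<noteq> {}" "closedin (phase_space S) M" "invariant_set G S M"
    using M by (auto simp: minimal_set_def)
  have "N = f ` M" if N: "N \<subseteq> f ` M" "N \<noteq> {}" "closedin (phase_space S') N"
      "invariant_set G S' N" for N
  proof -
    let ?L = "{\<tau> \<in> M. f \<tau> \<in> N}"
    have "closedin (phase_space S) ?L" "invariant_set G S ?L"
      by (rule epimorphism_preimage_closed[OF epi M'(2) N(3)],
          rule epimorphism_preimage_invariant[OF epi M'(3) N(4)])
    moreover have "?L \<noteq> {}"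
    proof -
      obtain \<nu> where "\<nu> \<in> N"
        using N(2) by blast
      then show ?thesis
        using N(1) by blast
    qed
    moreover have "?L \<subseteq> M"
      by blast
    ultimately have "?L = M"
      using M unfolding minimal_set_def psubset_eq by metis
    then show ?thesis
      using N(1) by blast
  qed
  then show ?thesis
    using M'(1) cl epimorphism_image_invariant[OF epi M'(3)] unfolding minimal_set_def
    by (metis image_is_empty psubset_eq)
qed

lemma epimorphism_lift_minimal:
  assumes S: "continuous_action G S" and S': "continuous_action G S'"
    and epi: "action_epimorphism G S S' f" and comp: "compact_space (phase_space S)"
    and M': "minimal_set G S' M'"
  obtains M where "minimal_set G S M" "f ` M = M'"
proof -
  have m: "M' \<noteq> {}" "closedin (phase_space S') M'" "invariant_set G S' M'"
    using M' by (auto simp: minimal_set_def)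
  have cont: "continuous_map (phase_space S) (phase_space S') f"
    and surj: "f ` topspace (phase_space S) = topspace (phase_space S')"
    using epi by (auto simp: action_epimorphism_def)
  let ?N = "{\<tau> \<in> topspace (phase_space S). f \<tau> \<in> M'}"
  have "invariant_set G S (topspace (phase_space S))"
    using continuous_action.act_in_topspace[OF S]
    by (auto simp: invariant_set_def actable_def source_fibre_def)
  then have N: "invariant_set G S ?N"
    by (rule epimorphism_preimage_invariant[OF epi _ m(3)])
  have N': "closedin (phase_space S) ?N"
    by (rule epimorphism_preimage_closed[OF epi closedin_topspace m(2)])
  obtain \<nu> where "\<nu> \<in> M'"
    using m(1) by blast
  moreover from this obtain \<tau> where "\<tau> \<in> topspace (phase_space S)" "f \<tau> = \<nu>"
    using closedin_subset[OF m(2)] surj by (metis imageE subsetD)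
  ultimately have "?N \<noteq> {}"
    by blast
  then obtain M where M: "M \<subseteq> ?N" "minimal_set G S M"
    using continuous_action.minimal_subset_exists[OF S comp _ N' N] by metis
  have Mp: "M \<noteq> {}" "closedin (phase_space S) M" "invariant_set G S M"
    using M(2) by (auto simp: minimal_set_def)
  have "compactin (phase_space S') (f ` M)"
    using closedin_compact_space[OF comp Mp(2)] cont by (rule image_compactin)
  then have "closedin (phase_space S') (f ` M)"
    by (rule compactin_imp_closedin[OF continuous_action.Hausdorff_phase_space[OF S']])
  moreover have "f ` M \<subseteq> M'" "f ` M \<noteq> {}"
    using M(1) Mp(1) by auto
  ultimately have "f ` M = M'"
    using continuous_action.minimal_setD[OF S' M'] epimorphism_image_invariant[OF epi Mp(3)]
    by metis
  with M(2) show ?thesis by (rule that)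
qed

lemma epimorphism_lift_almost_periodic:
  assumes S: "continuous_action G S" and S': "continuous_action G S'"
    and epi: "action_epimorphism G S S' f" and comp: "compact_space (phase_space S)"
    and comp': "compact_space (phase_space S')"
    and op: "open_groupoid G" and lc: "locally_compact_space (arrows G)"
    and ap: "almost_periodic G S' \<sigma>'"
  obtains \<sigma> where "almost_periodic G S \<sigma>" "\<sigma>' = f \<sigma>"
proof -
  interpret S': continuous_action G S' by (rule S')
  have top: "\<sigma>' \<in> topspace (phase_space S')"
    using ap by (simp add: almost_periodic_def)
  obtain M where M: "minimal_set G S M" "f ` M = phase_space S' closure_of orbit G S' \<sigma>'"
    using epimorphism_lift_minimal[OF S S' epi comp S'.minimal_closure_of_orbit[OF op comp' ap]]
    by blast
  moreover have "\<sigma>' \<in> phase_space S' closure_of orbit G S' \<sigma>'"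
    using S'.in_own_orbit[OF top] closure_of_subset[OF S'.orbit_subset[OF top]] by blast
  ultimately obtain \<sigma> where "\<sigma> \<in> M" "\<sigma>' = f \<sigma>"
    by (metis imageE)
  then show ?thesis
    using that continuous_action.almost_periodic_if_in_minimal[OF S op lc comp M(1)] by blast
qed

theorem proposition7p10:
  fixes G :: "'g groupoid"
    and S :: "('g, 's) groupoid_action"
    and S' :: "('g, 't) groupoid_action"
    and f :: "'s \<Rightarrow> 't"
  assumes "continuous_action G S"
    and "continuous_action G S'"
    and "action_epimorphism G S S' f"
  shows "(\<forall>M. minimal_set G S M \<and> closedin (phase_space S') (f ` M)
              \<longrightarrow> minimal_set G S' (f ` M)) \<and>
         (compact_space (phase_space S) \<longrightarrow>
            compact_space (phase_space S') \<and>
            (\<forall>M'. minimal_set G S' M' \<longrightarrow> (\<exists>M. minimal_set G S M \<and> f ` M = M')) \<and>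
            (open_groupoid G \<and> locally_compact_space (arrows G) \<longrightarrow>
               (\<forall>\<sigma>'. almost_periodic G S' \<sigma>' \<longrightarrow>
                  (\<exists>\<sigma>. almost_periodic G S \<sigma> \<and> \<sigma>' = f \<sigma>))))"
proof (intro conjI allI impI)
  fix M assume "minimal_set G S M \<and> closedin (phase_space S') (f ` M)"
  then show "minimal_set G S' (f ` M)"
    using epimorphism_image_minimal[OF assms(3)] by blast
next
  assume comp: "compact_space (phase_space S)"
  show comp': "compact_space (phase_space S')"
    using assms(3) comp image_compactin unfolding action_epimorphism_def compact_space_def
    by metis
  show "\<exists>M. minimal_set G S M \<and> f ` M = M'" if "minimal_set G S' M'" for M'
    using epimorphism_lift_minimal[OF assms comp that] by blast
  show "\<exists>\<sigma>. almost_periodic G S \<sigma> \<and> \<sigma>' = f \<sigma>"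
    if "open_groupoid G \<and> locally_compact_space (arrows G)" "almost_periodic G S' \<sigma>'" for \<sigma>'
    using epimorphism_lift_almost_periodic[OF assms comp comp'] that by blast
qed

end
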